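(* Let $p$ be an odd prime, let $n,k$ be positive integers, and let $f:\mathbb{Z}_p^n\to\mathbb{Z}_{p^k}$ be a gbent function. Then there exists a function $f^{\ast}:\mathbb{Z}_p^n\to\mathbb{Z}_{p^k}$ such that for every $\mathbf{u}\in\mathbb{Z}_p^n$, $$\mathcal{H}_f(\mathbf{u})=\begin{cases}\pm\,\zeta_{p^k}^{f^{\ast}(\mathbf{u})} & \text{if } n \text{ is even, or } n \text{ is odd and } p\equiv 1 \pmod 4,\\ \pm\sqrt{-1}\,\zeta_{p^k}^{f^{\ast}(\mathbf{u})} & \text{if } n \text{ is odd and } p\equiv 3 \pmod 4,\end{cases}$$ where the sign $\pm$ may depend on $\mathbf{u}$.
   Context: For a positive integer $m$, $\mathbb{Z}_m$ is the ring of integers modulo $m$ and $\zeta_m=e^{2\pi\sqrt{-1}/m}$. For $\mathbf{x},\mathbf{y}\in\mathbb{Z}_p^n$, $\mathbf{x}\cdot\mathbf{y}=x_1y_1+\cdots+x_ny_n \bmod p$. For a positive integer $q$ divisible by $p$ and $f:\mathbb{Z}_p^n\to\mathbb{Z}_q$, the generalized Walsh-Hadamard transform is $\mathcal{H}_f(\mathbf{u})=p^{-n/2}\sum_{\mathbf{x}\in\mathbb{Z}_p^n}\zeta_p^{-\mathbf{u}\cdot\mathbf{x}}\zeta_q^{f(\mathbf{x})}$ for $\mathbf{u}\in\mathbb{Z}_p^n$. The function $f$ is called gbent (generalized bent) if $|\mathcal{H}_f(\mathbf{u})|=1$ for all $\mathbf{u}\in\mathbb{Z}_p^n$. Here $q=p^k$.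 *)

theory Defs
  imports Complex_Main "HOL-Library.FuncSet" "HOL-Number_Theory.Number_Theory"
begin

definition Zmod :: "nat \<Rightarrow> int set" where
  "Zmod m = carrier (residue_ring (int m))"

text \<open>
  A vector over \<open>Zmod p\<close> is an extensional function on the index set \<open>{..<n}\<close>,
  so that the sum over \<open>Zvec p n\<close> counts each vector exactly once.
\<close>

definition Zvec :: "nat \<Rightarrow> nat \<Rightarrow> (nat \<Rightarrow> int) set" where
  "Zvec p n = {..<n} \<rightarrow>\<^sub>E Zmod p"

definition dotp :: "nat \<Rightarrow> nat \<Rightarrow> (nat \<Rightarrow> int) \<Rightarrow> (nat \<Rightarrow> int) \<Rightarrow> int" where
  "dotp p n x y = (\<Sum>i<n. x i * y i) mod int p"

definition zeta :: "nat \<Rightarrow> complex" where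
  "zeta m = exp (2 * of_real pi * \<i> / of_nat m)"

definition walsh :: "nat \<Rightarrow> nat \<Rightarrow> nat \<Rightarrow> ((nat \<Rightarrow> int) \<Rightarrow> int) \<Rightarrow> (nat \<Rightarrow> int) \<Rightarrow> complex" where
  "walsh p n q f u =
     of_real (real p powr (- (real n / 2))) *
     (\<Sum>x\<in>Zvec p n. zeta p powi (- dotp p n u x) * zeta q powi f x)"

definition gbent :: "nat \<Rightarrow> nat \<Rightarrow> nat \<Rightarrow> ((nat \<Rightarrow> int) \<Rightarrow> int) \<Rightarrow> bool" where
  "gbent p n q f \<longleftrightarrow> (\<forall>u\<in>Zvec p n. cmod (walsh p n q f u) = 1)"

end

theory Submission imports Defs "Jordan_Normal_Form.Char_Poly" begin

text \<open>
  Put \<open>z = \<zeta>\<^sub>q\<close> with \<open>q = p ^ k\<close>. The sum \<open>S = p ^ (n / 2) * walsh p n q f u\<close> lies in the ring \<open>R = \<int>[z]\<close>, and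
  gbentness says that its absolute value is \<open>p ^ (n / 2)\<close>. The argument uses two facts about \<open>R\<close>.

  First, \<open>p\<close> is a unit times a power of the prime \<open>1 - z\<close>, and complex conjugation fixes the ideal of
  this prime. Hence an element of \<open>R\<close> of absolute value \<open>p ^ N\<close> is divisible by \<open>p ^ N\<close>
  (\<open>p_power_dvd_of_norm\<close>). To have an integral exponent for all \<open>n\<close>, this is applied to \<open>S * g ^ n\<close>, where
  \<open>g\<close> is a square root of \<open>(-1) ^ ((p - 1) / 2) * p\<close> in \<open>R\<close> (\<open>ex_sqrt_signed_prime\<close>).

  Second, an element \<open>w\<close> of \<open>R\<close> of absolute value 1 is \<open>\<plusminus>z ^ j\<close> (\<open>norm_1_imp_root_of_unity\<close>). This
  replaces Kronecker's theorem by a count. All conjugates of \<open>w\<close> have absolute value 1 as well. The sum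
  of their squared absolute values is a quadratic form in the integer coefficients of \<open>w\<close>, and the value
  that it takes is the smallest nonzero value of the form, attained only at \<open>\<plusminus>z ^ j\<close>. That the
  conjugates of \<open>w\<close> are well defined is the irreducibility of the cyclotomic polynomial (\<open>conjugate_root\<close>), which follows
  from the \<open>(1 - z)\<close>-adic valuation by an argument in the style of Eisenstein.

  Together, \<open>S * g ^ n = \<plusminus>p ^ n * z ^ j\<close>. So the Walsh value is \<open>\<plusminus>(g / \<surd>p) ^ n * z ^ j\<close>, and \<open>g / \<surd>p\<close> is
  \<open>\<plusminus>1\<close> for \<open>p \<equiv> 1\<close> and \<open>\<plusminus>\<i>\<close> for \<open>p \<equiv> 3\<close> modulo 4.
\<close>

section \<open>Adjoining a complex number to the integers\<close>

definition int_adjoin :: "complex \<Rightarrow> complex set" where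
  "int_adjoin z = range (\<lambda>P. poly (of_int_poly P) z)"

lemma
  shows int_adjoin_of_int [simp, intro]: "of_int c \<in> int_adjoin z"
    and int_adjoin_gen [simp, intro]: "z \<in> int_adjoin z"
    and int_adjoin_add [intro]: "x \<in> int_adjoin z \<Longrightarrow> y \<in> int_adjoin z \<Longrightarrow> x + y \<in> int_adjoin z"
    and int_adjoin_diff [intro]: "x \<in> int_adjoin z \<Longrightarrow> y \<in> int_adjoin z \<Longrightarrow> x - y \<in> int_adjoin z"
    and int_adjoin_mult [intro]: "x \<in> int_adjoin z \<Longrightarrow> y \<in> int_adjoin z \<Longrightarrow> x * y \<in> int_adjoin z"
proof -
  show "of_int c \<in> int_adjoin z"
    unfolding int_adjoin_def by (rule image_eqI[of _ _ "[:c:]"]) (simp_all add: hom_distribs)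
  show "z \<in> int_adjoin z"
    unfolding int_adjoin_def by (rule image_eqI[of _ _ "[:0, 1:]"]) (simp_all add: hom_distribs)
next
  assume "x \<in> int_adjoin z" "y \<in> int_adjoin z"
  then obtain P Q where PQ: "x = poly (of_int_poly P) z" "y = poly (of_int_poly Q) z"
    unfolding int_adjoin_def by auto
  show "x + y \<in> int_adjoin z"
    unfolding int_adjoin_def PQ by (rule image_eqI[of _ _ "P + Q"]) (simp_all add: hom_distribs)
  show "x - y \<in> int_adjoin z"
    unfolding int_adjoin_def PQ by (rule image_eqI[of _ _ "P - Q"]) (simp_all add: hom_distribs)
  show "x * y \<in> int_adjoin z"
    unfolding int_adjoin_def PQ by (rule image_eqI[of _ _ "P * Q"]) (simp_all add: hom_distribs)
qed

lemma int_adjoin_0 [simp]: "0 \<in> int_adjoin z" and int_adjoin_1 [simp]: "1 \<in> int_adjoin z"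
  using int_adjoin_of_int[of 0] int_adjoin_of_int[of 1] by simp_all

lemma int_adjoin_of_nat [simp]: "of_nat c \<in> int_adjoin z"
  using int_adjoin_of_int[of "int c"] by simp

lemma int_adjoin_uminus [intro]: "x \<in> int_adjoin z \<Longrightarrow> - x \<in> int_adjoin z"
  using int_adjoin_diff[of 0 z x] by simp

lemma int_adjoin_power [intro]: "x \<in> int_adjoin z \<Longrightarrow> x ^ n \<in> int_adjoin z"
  by (induction n) auto

lemma int_adjoin_sum [intro]:
  "(\<And>i. i \<in> I \<Longrightarrow> f i \<in> int_adjoin z) \<Longrightarrow> (\<Sum>i\<in>I. f i) \<in> int_adjoin z"
  by (induction I rule: infinite_finite_induct) auto

lemma int_adjoin_prod [intro]:
  "(\<And>i. i \<in> I \<Longrightarrow> f i \<in> int_adjoin z) \<Longrightarrow> (\<Prod>i\<in>I. f i) \<in> int_adjoin z"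
  by (induction I rule: infinite_finite_induct) auto

section \<open>Roots of unity\<close>

lemma zeta_pow:
  assumes "N > 0"
  shows "zeta N ^ j = cis (2 * pi * real j / real N)"
  using assms by (simp add: zeta_def cis_conv_exp flip: exp_of_nat_mult) (simp add: field_simps)

lemma zeta_power_self [simp]: "N > 0 \<Longrightarrow> zeta N ^ N = 1"
  by (simp add: zeta_pow)

lemma norm_zeta [simp]: "cmod (zeta N) = 1"
proof -
  have "zeta N = cis (2 * pi / real N)"
    by (simp add: zeta_def cis_conv_exp algebra_simps)
  then show ?thesis by simp
qed

lemma zeta_nonzero [simp]: "zeta N \<noteq> 0"
  by (simp add: zeta_def)

lemma zeta_mult_power:
  assumes "a > 0" "b > 0"
  shows "zeta (a * b) ^ a = zeta b"
  using zeta_pow[of "a * b" a] zeta_pow[of b 1] assms by simp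

lemma zeta_power_mod: "N > 0 \<Longrightarrow> zeta N ^ (j mod N) = zeta N ^ j"
  by (subst (2) mult_div_mod_eq[of N j, symmetric], subst power_add) (simp add: power_mult)

lemma inj_on_zeta_power: "N > 0 \<Longrightarrow> inj_on (\<lambda>j. zeta N ^ j) {..<N}"
  using bij_betw_roots_unity[of N] by (simp add: zeta_pow bij_betw_def)

lemma zeta_power_eq_1_iff:
  assumes "N > 0" shows "zeta N ^ j = 1 \<longleftrightarrow> N dvd j"
proof -
  have "zeta N ^ j = 1 \<longleftrightarrow> zeta N ^ (j mod N) = zeta N ^ 0"
    using assms by (simp add: zeta_power_mod)
  also have "\<dots> \<longleftrightarrow> j mod N = 0"
    using inj_on_zeta_power[OF assms] assms by (auto simp: inj_on_def)
  finally show ?thesis by (simp add: dvd_eq_mod_eq_0)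
qed

lemma sum_zeta_powers:
  assumes "N > 0"
  shows "(\<Sum>j<N. (zeta N ^ d) ^ j) = (if N dvd d then of_nat N else 0)"
proof (cases "N dvd d")
  case True
  then have "zeta N ^ d = 1" using assms by (simp add: zeta_power_eq_1_iff)
  then show ?thesis using True by simp
next
  case False
  have "(\<Sum>j<N. (zeta N ^ d) ^ j) = ((zeta N ^ d) ^ N - 1) / (zeta N ^ d - 1)"
    using False assms by (intro geometric_sum) (simp add: zeta_power_eq_1_iff)
  also have "(zeta N ^ d) ^ N = 1"
    using assms by (simp flip: power_mult add: mult.commute[of d]) (simp add: power_mult)
  finally show ?thesis using False by simp
qed

lemma prod_linear_zeta:
  assumes "N > 0"
  shows "(\<Prod>j<N. [:- (zeta N ^ j), 1:]) = Polynomial.monom 1 N - 1" (is "?P = ?Q")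
proof -
  have deg: "degree ?P = N"
    by (subst degree_prod_eq_sum_degree) auto
  have lc: "lead_coeff ?P = 1"
    by (subst lead_coeff_prod) auto
  have degQ: "degree ?Q = N"
    using degree_add_eq_left[of "- 1" "Polynomial.monom (1::complex) N"] assms
    by (simp add: degree_monom_eq)
  have cQ: "lead_coeff ?Q = 1"
    unfolding degQ using assms by (simp add: coeff_1)
  show ?thesis
  proof (rule poly_eqI_degree_lead_coeff[of _ N _ "(\<lambda>j. zeta N ^ j) ` {..<N}"])
    show "N \<le> card ((\<lambda>j. zeta N ^ j) ` {..<N})"
      using assms by (simp add: card_image inj_on_zeta_power)
    show "poly ?P z = poly ?Q z" if "z \<in> (\<lambda>j. zeta N ^ j) ` {..<N}" for z
    proof -
      from that obtain j where j: "j < N" "z = zeta N ^ j" by auto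
      have "poly ?P z = 0" using j by (auto simp: poly_prod)
      moreover have "poly ?Q z = 0" using j assms
        by (simp add: poly_monom mult.commute[of _ N] flip: power_mult) (simp add: power_mult)
      ultimately show ?thesis by simp
    qed
  qed (use deg degQ lc cQ in auto)
qed

text \<open>
  The homogenised form of the factorisation of \<open>X ^ N - 1\<close>: evaluate it at \<open>1 / x\<close> and clear
  denominators.
\<close>

lemma prod_one_minus_zeta:
  assumes "N > 0"
  shows "(\<Prod>j<N. 1 - x * zeta N ^ j) = 1 - x ^ N"
proof (cases "x = 0")
  case True
  then show ?thesis using assms by simp
next
  case False
  have "(\<Prod>j<N. 1 - x * zeta N ^ j) = (\<Prod>j<N. x * (1 / x - zeta N ^ j))"
    using False by (simp add: right_diff_distrib)
  also have "\<dots> = x ^ N * poly (\<Prod>j<N. [:- (zeta N ^ j), 1:]) (1 / x)"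
    by (simp add: prod.distrib poly_prod)
  also have "\<dots> = 1 - x ^ N"
    using False unfolding prod_linear_zeta[OF assms] by (simp add: poly_monom field_simps)
  finally show ?thesis .
qed

text \<open>
  Cancel \<open>X - 1\<close> in the factorisation of \<open>X ^ N - 1\<close>, which leaves \<open>1 + X + \<dots> + X ^ (N - 1)\<close>,
  and evaluate at 1. For prime \<open>N\<close> this exhibits \<open>N\<close> as a product of numbers that will turn out to
  generate one and the same prime ideal.
\<close>

lemma prod_one_minus_zeta_eq:
  assumes "N > 0"
  shows "(\<Prod>j\<in>{1..<N}. 1 - zeta N ^ j) = of_nat N"
proof -
  have "[:-1, 1:] * (\<Prod>j\<in>{1..<N}. [:- (zeta N ^ j), 1:]) = (\<Prod>j<N. [:- (zeta N ^ j), 1:])"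
  proof -
    have "{..<N} = insert 0 {1..<N}" using assms by auto
    then show ?thesis by simp
  qed
  also have "\<dots> = [:-1, 1:] * (\<Sum>j<N. Polynomial.monom 1 j)"
  proof -
    have "[:-1, 1:] * (\<Sum>j<N. Polynomial.monom 1 j) = ([:0,1:] - 1) * (\<Sum>j<N. [:0, 1::complex:] ^ j)"
      by (simp add: one_pCons monom_altdef)
    also have "\<dots> = [:0,1:] ^ N - 1"
      by (simp add: power_diff_1_eq)
    finally show ?thesis unfolding prod_linear_zeta[OF assms] by (simp add: monom_altdef)
  qed
  finally have "(\<Prod>j\<in>{1..<N}. [:- (zeta N ^ j), 1:]) = (\<Sum>j<N. Polynomial.monom 1 j)"
    by (subst (asm) mult_left_cancel) auto
  then have "poly (\<Prod>j\<in>{1..<N}. [:- (zeta N ^ j), 1:]) 1 = poly (\<Sum>j<N. Polynomial.monom 1 j) 1"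
    by simp
  then show ?thesis by (simp add: poly_prod poly_sum poly_monom)
qed

lemma parseval_zeta:
  fixes b :: "nat \<Rightarrow> complex"
  assumes "N > 0"
  shows "(\<Sum>j<N. (cmod (\<Sum>r<N. b r * zeta N ^ (j * r)))\<^sup>2) = real N * (\<Sum>r<N. (cmod (b r))\<^sup>2)"
proof -
  have cz: "cnj (zeta N) = inverse (zeta N)"
    using complex_norm_square[of "zeta N"] by (simp add: inverse_unique)
  have *: "(\<Sum>j<N. zeta N ^ (j * r) * cnj (zeta N ^ (j * s))) = (if r = s then of_nat N else 0)"
    if "r < N" "s < N" for r s
  proof -
    have inv: "inverse (zeta N ^ s) = zeta N ^ (N - s)"
    proof -
      have "zeta N ^ s * zeta N ^ (N - s) = 1"
        using that assms by (simp flip: power_add)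
      then show ?thesis by (simp add: inverse_unique)
    qed
    have "(\<Sum>j<N. zeta N ^ (j * r) * cnj (zeta N ^ (j * s))) = (\<Sum>j<N. (zeta N ^ (r + (N - s))) ^ j)"
    proof (rule sum.cong[OF refl])
      fix j
      have "cnj (zeta N ^ (j * s)) = inverse (zeta N ^ s) ^ j"
        by (simp add: cz power_inverse flip: power_mult) (simp add: mult.commute)
      also have "\<dots> = (zeta N ^ (N - s)) ^ j" by (simp only: inv)
      finally show "zeta N ^ (j * r) * cnj (zeta N ^ (j * s)) = (zeta N ^ (r + (N - s))) ^ j"
        by (simp add: power_add power_mult_distrib flip: power_mult) (simp add: mult.commute)
    qed
    also have "\<dots> = (if N dvd r + (N - s) then of_nat N else 0)"
      by (rule sum_zeta_powers[OF assms])
    also have "N dvd r + (N - s) \<longleftrightarrow> r = s"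
    proof
      assume "N dvd r + (N - s)"
      then obtain t where t: "r + (N - s) = N * t" by blast
      have "0 < N * t" "N * t < N * 2" using t that by linarith+
      then have "t = 1" by (cases t) auto
      then show "r = s" using t that by simp
    qed (use that in simp)
    finally show ?thesis .
  qed
  have "complex_of_real (\<Sum>j<N. (cmod (\<Sum>r<N. b r * zeta N ^ (j * r)))\<^sup>2)
      = (\<Sum>j<N. \<Sum>r<N. \<Sum>s<N. b r * cnj (b s) * (zeta N ^ (j * r) * cnj (zeta N ^ (j * s))))"
    by (simp only: of_real_sum complex_norm_square cnj_sum sum_product complex_cnj_mult)
       (intro sum.cong refl, simp)
  also have "\<dots> = (\<Sum>r<N. \<Sum>j<N. \<Sum>s<N. b r * cnj (b s) * (zeta N ^ (j * r) * cnj (zeta N ^ (j * s))))"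
    by (rule sum.swap)
  also have "\<dots> = (\<Sum>r<N. \<Sum>s<N. \<Sum>j<N. b r * cnj (b s) * (zeta N ^ (j * r) * cnj (zeta N ^ (j * s))))"
    by (intro sum.cong refl sum.swap)
  also have "\<dots> = (\<Sum>r<N. \<Sum>s<N. b r * cnj (b s) * (if r = s then of_nat N else 0))"
    by (intro sum.cong refl) (simp only: sum_distrib_left [symmetric] lessThan_iff *)
  also have "\<dots> = (\<Sum>r<N. of_nat N * (b r * cnj (b r)))"
    by (intro sum.cong refl) (simp add: if_distrib sum.delta mult.commute cong: if_cong)
  also have "\<dots> = complex_of_real (real N * (\<Sum>r<N. (cmod (b r))\<^sup>2))"
    by (simp only: of_real_mult of_real_sum complex_norm_square sum_distrib_left of_real_of_nat_eq)
  finally show ?thesis by (simp only: of_real_eq_iff)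
qed

section \<open>Integrality of the adjoined ring\<close>

lemma int_adjoin_root_of_unity_span:
  assumes "z ^ N = 1" "N > 0" "x \<in> int_adjoin z"
  shows "\<exists>a :: nat \<Rightarrow> int. x = (\<Sum>j<N. of_int (a j) * z ^ j)"
proof -
  obtain M where M: "N = Suc M" using assms(2) by (cases N) auto
  have "\<exists>a :: nat \<Rightarrow> int. poly (of_int_poly P) z = (\<Sum>j<N. of_int (a j) * z ^ j)" for P
  proof (induction P)
    case 0
    show ?case by (rule exI[of _ "\<lambda>_. 0"]) simp
  next
    case (pCons c P)
    then obtain a :: "nat \<Rightarrow> int" where a: "poly (of_int_poly P) z = (\<Sum>j<N. of_int (a j) * z ^ j)"
      by blast
    define b where "b j = (case j of 0 \<Rightarrow> c + a M | Suc i \<Rightarrow> a i)" for j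
    have "(\<Sum>j<N. of_int (b j) * z ^ j) = of_int (c + a M) + (\<Sum>j<M. of_int (a j) * z ^ Suc j)"
      unfolding M sum.lessThan_Suc_shift by (simp add: b_def)
    also have "\<dots> = of_int c + (\<Sum>j<N. of_int (a j) * z ^ Suc j)"
      using assms(1) unfolding M by simp
    also have "\<dots> = poly (of_int_poly (pCons c P)) z"
      by (simp add: a hom_distribs sum_distrib_left mult_ac)
    finally show ?case by metis
  qed
  then show ?thesis using assms(3) unfolding int_adjoin_def by auto
qed

text \<open>
  Multiplication by \<open>x\<close> maps each of \<open>1, z, \<dots>, z ^ (N - 1)\<close> to an integer combination of these
  powers, so \<open>x\<close> is an eigenvalue of an integer matrix and hence a root of its monic integral
  characteristic polynomial.
\<close>

lemma int_adjoin_root_of_unity_algebraic_int: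
  assumes "z ^ N = 1" "N > 0" "x \<in> int_adjoin z"
  shows "algebraic_int x"
proof -
  have "\<forall>i. \<exists>a :: nat \<Rightarrow> int. x * z ^ i = (\<Sum>j<N. of_int (a j) * z ^ j)"
    using assms by (intro allI int_adjoin_root_of_unity_span) auto
  then obtain a :: "nat \<Rightarrow> nat \<Rightarrow> int" where a: "\<And>i. x * z ^ i = (\<Sum>j<N. of_int (a i j) * z ^ j)"
    by metis
  define A where "A = mat N N (\<lambda>(i, j). a i j)"
  have A: "A \<in> carrier_mat N N" by (simp add: A_def)
  define v where "v = vec N (\<lambda>j. z ^ j)"
  have "v $ 0 \<noteq> 0\<^sub>v N $ 0" using assms(2) by (simp add: v_def)
  then have "v \<noteq> 0\<^sub>v N" by auto
  moreover have "map_mat of_int A *\<^sub>v v = x \<cdot>\<^sub>v v"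
  proof (rule eq_vecI)
    fix i assume "i < dim_vec (x \<cdot>\<^sub>v v)"
    then show "(map_mat of_int A *\<^sub>v v) $ i = (x \<cdot>\<^sub>v v) $ i"
      by (simp add: A_def v_def a scalar_prod_def atLeast0LessThan)
  qed (simp add: A_def v_def)
  ultimately have "eigenvalue (map_mat of_int A) x"
    unfolding eigenvalue_def eigenvector_def using A by (intro exI[of _ v]) (simp add: v_def)
  then have "poly (of_int_poly (char_poly A)) x = 0"
    using A by (simp add: eigenvalue_root_char_poly[of _ N] flip: of_int_hom.char_poly_hom)
  moreover have "lead_coeff (char_poly A) = 1"
    using degree_monic_char_poly[OF A] by simp
  ultimately show ?thesis
    unfolding algebraic_int_altdef_ipoly by blast
qed

text \<open>
  Applied to \<open>c = p\<close>, this is what keeps the prime above \<open>p\<close> from being a unit; every later statement that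
  something is not divisible rests on it.
\<close>

lemma inverse_nat_notin_int_adjoin:
  assumes "z ^ N = 1" "N > 0" "c > 1"
  shows "1 / of_nat c \<notin> int_adjoin z"
proof
  assume "1 / of_nat c \<in> int_adjoin z"
  then have "algebraic_int (1 / of_nat c :: complex)"
    using assms int_adjoin_root_of_unity_algebraic_int by blast
  then have "1 / of_nat c \<in> (\<int> :: complex set)"
    by (rule rational_algebraic_int_is_int) simp
  then obtain t where "1 / of_nat c = (of_int t :: complex)" by (auto elim: Ints_cases)
  then have "(of_int (t * int c) :: complex) = of_int 1" using assms(3) by (simp add: field_simps)
  then have "t * int c = 1" by (simp only: of_int_eq_iff)
  then have "int c dvd 1" by (metis dvd_triv_right)
  then show False using assms(3) by simp
qed

section \<open>The prime above p\<close>

text \<open>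
  The cyclotomic ring \<open>R = \<int>[z]\<close> for a primitive \<open>p ^ k\<close>-th root of unity \<open>z\<close>. Here \<open>\<phi>\<close> is the totient of
  \<open>p ^ k\<close>, and \<open>lam = 1 - z\<close> generates the only prime ideal of \<open>R\<close> that contains \<open>p\<close>.
\<close>

locale prime_power_root =
  fixes p k :: nat
  assumes prime_p: "prime p" and k_pos: "k > 0"
begin

abbreviation "q \<equiv> p ^ k"
abbreviation "m \<equiv> p ^ (k - 1)"
abbreviation "\<phi> \<equiv> m * (p - 1)"
abbreviation "z \<equiv> zeta q"
abbreviation "lam \<equiv> 1 - z"
abbreviation "R \<equiv> int_adjoin z"

text \<open>
  Divisibility with a cofactor in \<open>R\<close>. The type class relation \<open>dvd\<close> on complex numbers cannot serve,
  because every nonzero complex number divides every other one.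
\<close>

definition rdvd :: "complex \<Rightarrow> complex \<Rightarrow> bool" where
  "rdvd x y \<longleftrightarrow> (\<exists>s\<in>R. y = x * s)"

lemma p_gt_1: "p > 1" using prime_p by (rule prime_gt_1_nat)
lemma m_pos: "m > 0" using p_gt_1 by simp
lemma q_pos: "q > 0" using p_gt_1 by simp
lemma q_eq: "q = p * m" using k_pos by (cases k) auto
lemma q_gt_1: "q > 1" using q_eq p_gt_1 m_pos by (metis less_le_trans mult.commute mult_le_mono1 nat_mult_1 One_nat_def Suc_leI)
lemma z_q [simp]: "z ^ q = 1" using q_pos by simp
lemma z_p: "z ^ p = zeta m" unfolding q_eq using p_gt_1 m_pos by (simp add: zeta_mult_power)
lemma z_m: "z ^ m = zeta p" unfolding q_eq using p_gt_1 m_pos by (simp add: zeta_mult_power mult.commute[of p])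
lemma lam_nonzero: "lam \<noteq> 0"
  using zeta_power_eq_1_iff[OF q_pos, of 1] q_gt_1 by auto

lemma rdvd_refl [simp]: "rdvd x x"
  unfolding rdvd_def by (rule bexI[of _ 1]) auto
lemma rdvd_0 [simp]: "rdvd x 0"
  unfolding rdvd_def by (rule bexI[of _ 0]) auto
lemma rdvd_trans: "rdvd x y \<Longrightarrow> rdvd y w \<Longrightarrow> rdvd x w"
  unfolding rdvd_def by (metis int_adjoin_mult mult.assoc)
lemma rdvd_mult: "rdvd x y \<Longrightarrow> w \<in> R \<Longrightarrow> rdvd x (y * w)"
  unfolding rdvd_def by (metis int_adjoin_mult mult.assoc)
lemma rdvd_add: "rdvd x y \<Longrightarrow> rdvd x w \<Longrightarrow> rdvd x (y + w)"
  unfolding rdvd_def by (metis int_adjoin_add ring_distribs(1))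
lemma rdvd_uminus: "rdvd x y \<Longrightarrow> rdvd x (- y)"
  unfolding rdvd_def by (metis int_adjoin_uminus mult_minus_right)
lemma rdvd_diff: "rdvd x y \<Longrightarrow> rdvd x w \<Longrightarrow> rdvd x (y - w)"
  using rdvd_add[of x y "- w"] rdvd_uminus by simp
lemma rdvd_sum: "(\<And>i. i \<in> I \<Longrightarrow> rdvd x (f i)) \<Longrightarrow> rdvd x (\<Sum>i\<in>I. f i)"
  by (induction I rule: infinite_finite_induct) (auto intro: rdvd_add)
lemma rdvd_cancel: "c \<noteq> 0 \<Longrightarrow> rdvd (c * x) (c * y) \<longleftrightarrow> rdvd x y"
  unfolding rdvd_def by (simp add: mult.assoc)
lemma rdvd_power_mono: "x \<in> R \<Longrightarrow> i \<le> j \<Longrightarrow> rdvd (x ^ i) (x ^ j)"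
  unfolding rdvd_def by (rule bexI[of _ "x ^ (j - i)"]) (auto simp flip: power_add)
lemma lam_in_R [simp]: "lam \<in> R" by auto

lemma cnj_z: "cnj z = z ^ (q - 1)"
proof -
  have "z * cnj z = 1" using complex_norm_square[of z] by simp
  moreover have "z * z ^ (q - 1) = 1"
    using z_q q_pos by (metis power_eq_if neq0_conv)
  ultimately show ?thesis
    using zeta_nonzero by (metis mult_left_cancel)
qed

lemma poly_cnj_int: "poly (of_int_poly P) (cnj x) = cnj (poly (of_int_poly P) x)"
  by (induction P) (simp_all add: hom_distribs)

lemma int_adjoin_cnj:
  assumes "x \<in> R" shows "cnj x \<in> R"
proof -
  from assms obtain P where P: "x = poly (of_int_poly P) z"
    unfolding int_adjoin_def by auto
  have "poly (of_int_poly P) y \<in> R" if "y \<in> R" for y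
    using that by (induction P) (auto simp: hom_distribs)
  then show ?thesis unfolding P poly_cnj_int[symmetric] cnj_z by auto
qed

text \<open>
  The quotient of \<open>1 - z ^ j\<close> by \<open>1 - z\<close> is a geometric sum, hence in \<open>R\<close>. So is the reverse quotient:
  with \<open>j j' \<equiv> 1\<close> modulo \<open>p ^ k\<close>, the number \<open>z\<close> is the \<open>j'\<close>-th power of \<open>z ^ j\<close>.
\<close>

lemma one_minus_z_power_unit:
  assumes "\<not> p dvd j"
  shows "\<exists>u\<in>R. \<exists>u'\<in>R. u * u' = 1 \<and> 1 - z ^ j = u * lam"
proof -
  have "coprime j q"
    using prime_imp_coprime[OF prime_p assms] by (simp add: coprime_commute)
  then obtain j' where "[j * j' = 1] (mod q)"
    using cong_solve_coprime_nat[of j q] by auto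
  then have "z ^ (j * j') = z ^ 1"
    using q_pos by (metis zeta_power_mod unique_euclidean_semiring_class.cong_def)
  then have inv: "(1 - z ^ j) * (\<Sum>i<j'. (z ^ j) ^ i) = lam"
    using one_diff_power_eq[of "z ^ j" j'] by (simp only: power_mult power_one_right)
  have u: "1 - z ^ j = (\<Sum>i<j. z ^ i) * lam"
    by (subst one_diff_power_eq) (rule mult.commute)
  have "lam * ((\<Sum>i<j. z ^ i) * (\<Sum>i<j'. (z ^ j) ^ i)) = lam"
    using inv by (simp only: u mult_ac)
  then have "(\<Sum>i<j. z ^ i) * (\<Sum>i<j'. (z ^ j) ^ i) = 1"
    using lam_nonzero mult_cancel_left2 by blast
  then show ?thesis using u
    by (intro bexI[of _ "\<Sum>i<j. z ^ i"] bexI[of _ "\<Sum>i<j'. (z ^ j) ^ i"]) auto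
qed

text \<open>
  Total ramification of \<open>p\<close>. The product \<open>p = \<Prod>(1 - \<zeta>\<^sub>p ^ i)\<close> over \<open>0 < i < p\<close> refines to the product of
  all \<open>1 - z ^ j\<close> with \<open>0 \<le> j < p ^ k\<close> prime to \<open>p\<close>, and there are \<open>\<phi>\<close> such factors, each a unit times
  \<open>lam\<close>.
\<close>

lemma p_eq_unit_lam_power:
  "\<exists>v\<in>R. \<exists>v'\<in>R. v * v' = 1 \<and> of_nat p = v * lam ^ \<phi>"
proof -
  obtain u u' where u: "\<And>j. \<not> p dvd j \<Longrightarrow> u j \<in> R \<and> u' j \<in> R \<and> u j * u' j = 1 \<and> 1 - z ^ j = u j * lam"
    using one_minus_z_power_unit by metis
  have nd: "\<not> p dvd (i + p * t)" if "i \<in> {1..<p}" for i t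
    using that by (simp add: dvd_add_left_iff nat_dvd_not_less)
  have "of_nat p = (\<Prod>i\<in>{1..<p}. 1 - zeta p ^ i)"
    using p_gt_1 by (subst prod_one_minus_zeta_eq) auto
  also have "\<dots> = (\<Prod>i\<in>{1..<p}. \<Prod>t<m. 1 - z ^ (i + p * t))"
  proof (rule prod.cong[OF refl])
    fix i
    have "1 - zeta p ^ i = 1 - (z ^ i) ^ m"
      unfolding z_m[symmetric] by (simp add: mult.commute flip: power_mult)
    also have "\<dots> = (\<Prod>t<m. 1 - z ^ i * zeta m ^ t)"
      by (rule prod_one_minus_zeta[OF m_pos, symmetric])
    finally show "1 - zeta p ^ i = (\<Prod>t<m. 1 - z ^ (i + p * t))"
      unfolding z_p[symmetric] by (simp add: power_add power_mult)
  qed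
  also have "\<dots> = (\<Prod>i\<in>{1..<p}. \<Prod>t<m. u (i + p * t) * lam)"
    by (intro prod.cong refl) (use u nd in blast)
  also have "\<dots> = (\<Prod>i\<in>{1..<p}. \<Prod>t<m. u (i + p * t)) * lam ^ \<phi>"
    by (simp add: prod.distrib power_mult)
  finally have eq: "of_nat p = (\<Prod>i\<in>{1..<p}. \<Prod>t<m. u (i + p * t)) * lam ^ \<phi>" .
  have "(\<Prod>i\<in>{1..<p}. \<Prod>t<m. u (i + p * t)) * (\<Prod>i\<in>{1..<p}. \<Prod>t<m. u' (i + p * t)) = 1"
    unfolding prod.distrib[symmetric] by (intro prod.neutral ballI) (use u nd in blast)
  moreover have "(\<Prod>i\<in>{1..<p}. \<Prod>t<m. u (i + p * t)) \<in> R" "(\<Prod>i\<in>{1..<p}. \<Prod>t<m. u' (i + p * t)) \<in> R"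
    by (intro int_adjoin_prod; use u nd in blast)+
  ultimately show ?thesis using eq by blast
qed

lemma rdvd_lam_power_p: "rdvd (lam ^ \<phi>) (of_nat p)"
  using p_eq_unit_lam_power unfolding rdvd_def by (metis mult.commute)

lemma rdvd_p_lam_power: "rdvd (of_nat p) (lam ^ \<phi>)"
proof -
  obtain v v' where v: "v' \<in> R" "v * v' = 1" "of_nat p = v * lam ^ \<phi>"
    using p_eq_unit_lam_power by blast
  then have "lam ^ \<phi> = of_nat p * v'" by (simp add: mult_ac)
  then show ?thesis using v(1) unfolding rdvd_def by blast
qed

lemma phi_pos: "\<phi> > 0" using p_gt_1 by simp

lemma rdvd_lam_p: "rdvd lam (of_nat p)"
proof -
  have "rdvd (lam ^ 1) (lam ^ \<phi>)" using phi_pos by (intro rdvd_power_mono) auto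
  then show ?thesis using rdvd_trans[OF _ rdvd_lam_power_p, of lam] by simp
qed

lemma lam_not_unit: "\<not> rdvd lam 1"
proof
  assume "rdvd lam 1"
  then obtain s where s: "s \<in> R" "1 = lam * s" unfolding rdvd_def by blast
  obtain t where t: "t \<in> R" "lam ^ \<phi> = of_nat p * t"
    using rdvd_p_lam_power unfolding rdvd_def by blast
  have "1 = (lam * s) ^ \<phi>" using s by simp
  also have "\<dots> = of_nat p * (t * s ^ \<phi>)" by (simp only: power_mult_distrib t mult.assoc)
  finally have "1 / of_nat p = t * s ^ \<phi>" using p_gt_1 by (simp add: field_simps)
  moreover have "t * s ^ \<phi> \<in> R" using s t by auto
  ultimately show False
    using inverse_nat_notin_int_adjoin[OF z_q q_pos p_gt_1] by simp
qed

text \<open>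
  If \<open>c\<close> were prime to \<open>p\<close>, Bezout's identity would make \<open>lam\<close>, which divides both, a divisor of 1.
\<close>

lemma rdvd_lam_int_imp:
  assumes "rdvd lam (of_int c)"
  shows "int p dvd c"
proof (rule ccontr)
  assume "\<not> int p dvd c"
  then have "coprime (int p) c"
    using prime_p by (intro prime_imp_coprime) auto
  then obtain x y where xy: "x * int p + y * c = 1"
    using bezout_int[of "int p" c] by auto
  have "rdvd lam (of_nat p * of_int x + of_int c * of_int y)"
    using assms rdvd_lam_p by (intro rdvd_add rdvd_mult) auto
  also have "of_nat p * of_int x + of_int c * of_int y = (of_int (x * int p + y * c) :: complex)"
    by (simp add: mult_ac)
  finally show False using xy lam_not_unit by simp
qed

text \<open>
  Modulo \<open>lam\<close> the generator \<open>z\<close> is congruent to 1, so an integer polynomial in \<open>z\<close> is congruent to its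
  value at 1. Thus the residue ring of \<open>R\<close> modulo \<open>lam\<close> is the field with \<open>p\<close> elements.
\<close>

lemma cong_int_mod_lam:
  assumes "x \<in> R"
  shows "\<exists>c. rdvd lam (x - of_int c)"
proof -
  have "\<exists>c. rdvd lam (poly (of_int_poly P) z - of_int c)" for P
  proof (induction P)
    case 0
    show ?case by (rule exI[of _ 0]) simp
  next
    case (pCons a P)
    then obtain c where c: "rdvd lam (poly (of_int_poly P) z - of_int c)" by blast
    have "rdvd lam ((poly (of_int_poly P) z - of_int c) - lam * poly (of_int_poly P) z)"
      by (intro rdvd_diff[OF c] rdvd_mult) (auto simp: int_adjoin_def)
    then show ?case
      by (intro exI[of _ "a + c"]) (simp add: hom_distribs algebra_simps)
  qed
  then show ?thesis using assms by (auto simp: int_adjoin_def)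
qed

lemma lam_prime:
  assumes "x \<in> R" "y \<in> R" "rdvd lam (x * y)"
  shows "rdvd lam x \<or> rdvd lam y"
proof -
  obtain a b where a: "rdvd lam (x - of_int a)" and b: "rdvd lam (y - of_int b)"
    using cong_int_mod_lam assms by metis
  have *: "rdvd lam w" if "rdvd lam (w - of_int c)" "int p dvd c" for w c
  proof -
    from that(2) obtain d where "c = int p * d" by blast
    then have "rdvd lam (of_int c)"
      using rdvd_mult[OF rdvd_lam_p, of "of_int d"] by simp
    from rdvd_add[OF that(1) this] show ?thesis by simp
  qed
  have "rdvd lam (x * y - (x - of_int a) * y - (y - of_int b) * of_int a)"
    by (rule rdvd_diff[OF rdvd_diff[OF assms(3) rdvd_mult[OF a assms(2)]] rdvd_mult[OF b]]) simp
  then have "rdvd lam (of_int (a * b))" by (simp add: algebra_simps)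
  then have "int p dvd a * b" by (rule rdvd_lam_int_imp)
  then have "int p dvd a \<or> int p dvd b"
    using prime_p by (simp add: prime_dvd_mult_iff)
  then show ?thesis using * a b by blast
qed

section \<open>Irreducibility of the cyclotomic polynomial\<close>

text \<open>
  Compare \<open>lam\<close>-adic orders. Once the coefficients below \<open>i\<close> are divisible by \<open>p\<close>, their terms are
  divisible by \<open>lam ^ \<phi>\<close>, hence by \<open>lam ^ (i + 1)\<close>, as are the terms above \<open>i\<close>. So \<open>lam\<close> divides
  the coefficient at \<open>i\<close>, and then \<open>p\<close> does.
\<close>

lemma lam_relation_coeffs_dvd:
  assumes "(\<Sum>i<\<phi>. of_int (d i) * lam ^ i) = 0" "i < \<phi>"
  shows "int p dvd d i"
  using assms(2)
proof (induction i rule: less_induct)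
  case (less i)
  have split: "{..<\<phi>} = insert i ({..<i} \<union> {i<..<\<phi>})"
    using less.prems by auto
  have eq: "0 = lam ^ i * of_int (d i) + ((\<Sum>j<i. of_int (d j) * lam ^ j) + (\<Sum>j\<in>{i<..<\<phi>}. of_int (d j) * lam ^ j))"
    unfolding assms(1)[symmetric] split
    by (subst sum.insert, simp, simp, subst sum.union_disjoint) (auto simp: mult.commute)
  have "rdvd (lam ^ Suc i) (of_int (d j) * lam ^ j)" if "j < i" for j
  proof -
    have "int p dvd d j" using less that by simp
    then obtain e where e: "d j = int p * e" by blast
    have "rdvd (lam ^ Suc i) (lam ^ \<phi>)" using less.prems by (intro rdvd_power_mono) auto
    then have "rdvd (lam ^ Suc i) (of_nat p * (of_int e * lam ^ j))"
      by (rule rdvd_mult[OF rdvd_trans[OF _ rdvd_lam_power_p]])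
        (intro int_adjoin_mult int_adjoin_power int_adjoin_of_int lam_in_R)
    then show ?thesis by (simp add: e mult_ac)
  qed
  moreover have "rdvd (lam ^ Suc i) (of_int (d j) * lam ^ j)" if "j > i" for j
    using rdvd_mult[OF rdvd_power_mono[of lam "Suc i" j], of "of_int (d j)"] that
    by (simp add: mult.commute)
  ultimately have rest: "rdvd (lam ^ Suc i) ((\<Sum>j<i. of_int (d j) * lam ^ j) + (\<Sum>j\<in>{i<..<\<phi>}. of_int (d j) * lam ^ j))"
    by (intro rdvd_add rdvd_sum) auto
  have "rdvd (lam ^ Suc i) (lam ^ i * of_int (d i))"
    using rdvd_diff[OF rdvd_0 rest] unfolding eq by (simp only: add_diff_cancel_right')
  then have "rdvd (lam ^ i * lam) (lam ^ i * of_int (d i))" by (simp only: power_Suc2)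
  then have "rdvd lam (of_int (d i))"
    using lam_nonzero by (subst (asm) rdvd_cancel) auto
  then show ?case by (rule rdvd_lam_int_imp)
qed

text \<open>
  Infinite descent: dividing all coefficients by \<open>p\<close> gives another relation, so they are divisible by
  every power of \<open>p\<close>.
\<close>

lemma lam_powers_independent:
  assumes "(\<Sum>i<\<phi>. of_int (d i) * lam ^ i) = 0" "i < \<phi>"
  shows "d i = 0"
proof (rule ccontr)
  assume "d i \<noteq> 0"
  have "\<forall>d. (\<Sum>i<\<phi>. of_int (d i) * lam ^ i) = 0 \<longrightarrow> (\<forall>i<\<phi>. int p ^ N dvd d i)" for N
  proof (induction N)
    case (Suc N)
    show ?case
    proof (intro allI impI)
      fix d i assume d: "(\<Sum>i<\<phi>. of_int (d i) * lam ^ i) = 0" and i: "i < \<phi>"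
      define e where "e j = d j div int p" for j
      have e: "d j = int p * e j" if "j < \<phi>" for j
        using lam_relation_coeffs_dvd[OF d that] by (simp add: e_def)
      have "of_nat p * (\<Sum>i<\<phi>. of_int (e i) * lam ^ i) = (\<Sum>i<\<phi>. of_int (d i) * lam ^ i)"
        unfolding sum_distrib_left by (intro sum.cong refl) (simp add: e mult_ac)
      then have "(\<Sum>i<\<phi>. of_int (e i) * lam ^ i) = 0"
        using d p_gt_1 by simp
      then have "int p ^ N dvd e i" using Suc i by blast
      then show "int p ^ Suc N dvd d i" by (simp add: e[OF i])
    qed
  qed simp
  \<comment> \<open>Any exponent \<open>N \<ge> \<bar>d i\<bar>\<close> contradicts \<open>d i \<noteq> 0\<close>, because \<open>N < p ^ N\<close>.\<close>
  then have "int p ^ nat \<bar>d i\<bar> dvd d i" using assms by blast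
  then have "int p ^ nat \<bar>d i\<bar> \<le> \<bar>d i\<bar>"
    using \<open>d i \<noteq> 0\<close> by (metis dvd_imp_le_int abs_of_nat of_nat_power)
  moreover have "nat \<bar>d i\<bar> < p ^ nat \<bar>d i\<bar>" using p_gt_1 by (simp add: power_gt_expt)
  then have "\<bar>d i\<bar> < int p ^ nat \<bar>d i\<bar>"
    by (metis abs_ge_zero nat_less_iff of_nat_power)
  ultimately show False by simp
qed

text \<open>
  The cyclotomic polynomial of order \<open>p ^ k\<close>.
\<close>

definition Phi :: "int poly" where
  "Phi = (\<Sum>i<p. Polynomial.monom 1 (m * i))"

lemma poly_Phi: "poly (of_int_poly Phi) x = (\<Sum>i<p. (x ^ m) ^ i)"
  for x :: complex
  by (simp add: Phi_def hom_distribs poly_sum poly_monom power_mult)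

lemma poly_Phi_primitive:
  assumes "\<not> p dvd j"
  shows "poly (of_int_poly Phi) (z ^ j) = 0"
proof -
  have "poly (of_int_poly Phi) (z ^ j) = (\<Sum>i<p. (zeta p ^ j) ^ i)"
    unfolding poly_Phi z_m[symmetric] by (simp add: mult.commute flip: power_mult)
  then show ?thesis using sum_zeta_powers[of p j] assms p_gt_1 by simp
qed

lemma coeff_Phi: "coeff Phi e = (if m dvd e \<and> e < p * m then 1 else 0)"
proof -
  have "coeff Phi e = (\<Sum>i<p. if m * i = e then 1 else 0)"
    by (simp add: Phi_def coeff_sum)
  also have "\<dots> = (if m dvd e \<and> e < p * m then 1 else 0)"
  proof (cases "m dvd e")
    case True
    then obtain i where i: "e = m * i" by blast
    have "(\<Sum>j<p. if m * j = e then 1 else 0) = (\<Sum>j<p. if j = i then 1 else (0::int))"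
      using m_pos by (intro sum.cong refl) (auto simp: i)
    then show ?thesis using m_pos by (auto simp: i mult.commute)
  next
    case False
    then have "m * i \<noteq> e" for i by auto
    with False show ?thesis by simp
  qed
  finally show ?thesis .
qed

lemma Phi_monic: "degree Phi = \<phi>" "lead_coeff Phi = 1"
proof -
  have c1: "coeff Phi \<phi> = 1"
    using p_gt_1 m_pos by (simp add: coeff_Phi mult.commute[of p])
  have c0: "coeff Phi e = 0" if "e > \<phi>" for e
  proof (rule ccontr)
    assume "coeff Phi e \<noteq> 0"
    then have "m dvd e" "e < p * m" by (auto simp: coeff_Phi split: if_splits)
    then obtain i where "e = m * i" "m * i < m * p" by (auto simp: mult.commute)
    then have "i \<le> p - 1" using m_pos by auto
    then show False using that \<open>e = m * i\<close> by (metis mult_le_mono2 not_less)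
  qed
  show "degree Phi = \<phi>"
    using c1 c0 by (intro antisym degree_le le_degree) auto
  with c1 show "lead_coeff Phi = 1" by simp
qed

text \<open>
  The Galois conjugates of \<open>z\<close>: an integral relation for \<open>z\<close> also holds for every other primitive
  \<open>p ^ k\<close>-th root of unity. Reduce the relation modulo \<open>Phi\<close>; the remainder has degree below \<open>\<phi>\<close> and
  vanishes by the independence of the powers of \<open>lam\<close>, so \<open>Phi\<close> divides the relation.
\<close>

lemma conjugate_root:
  assumes "poly (of_int_poly P) z = 0" "\<not> p dvd j"
  shows "poly (of_int_poly P) (z ^ j) = 0"
proof -
  obtain Q r where Qr: "pseudo_divmod P Phi = (Q, r)" by fastforce
  have "Phi \<noteq> 0" using Phi_monic(2) by auto
  from pseudo_divmod[OF this Qr] have P: "P = Phi * Q + r" and r: "r = 0 \<or> degree r < \<phi>"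
    using Phi_monic by auto
  have P': "poly (of_int_poly P) x = poly (of_int_poly Phi) x * poly (of_int_poly Q) x + poly (of_int_poly r) x" for x :: complex
    unfolding P by (simp add: hom_distribs)
  have rz: "poly (of_int_poly r) z = 0"
    using assms(1) poly_Phi_primitive[of 1] p_gt_1 by (simp add: P')
  \<comment> \<open>The substitution of \<open>1 - X\<close> for \<open>X\<close> expands the remainder in powers of \<open>lam\<close>.\<close>
  define D where "D = r \<circ>\<^sub>p [:1, -1:]"
  have degD: "degree D = degree r" by (simp add: D_def)
  have "of_int_poly D = of_int_poly r \<circ>\<^sub>p [:1, -1 :: complex:]"
    by (simp add: D_def hom_distribs)
  then have Dlam: "poly (of_int_poly D) lam = 0"
    using rz by (simp add: poly_pcompose)
  have "r = 0"
  proof (rule ccontr)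
    assume "r \<noteq> 0"
    then have deg: "degree D < \<phi>" using r degD by simp
    have "poly (of_int_poly D) lam = (\<Sum>i\<le>degree D. of_int (coeff D i) * lam ^ i)"
      by (simp add: poly_altdef)
    also have "\<dots> = (\<Sum>i<\<phi>. of_int (coeff D i) * lam ^ i)"
      using deg by (intro sum.mono_neutral_left) (auto simp: coeff_eq_0)
    finally have "(\<Sum>i<\<phi>. of_int (coeff D i) * lam ^ i) = 0" using Dlam by simp
    then have "coeff D i = 0" for i
      using lam_powers_independent[of "coeff D" i] deg by (cases "i < \<phi>") (auto simp: coeff_eq_0)
    then have "D = 0" by (simp add: poly_eq_iff)
    then show False using \<open>r \<noteq> 0\<close> unfolding D_def by (subst (asm) pcompose_eq_0_iff) auto
  qed
  then show ?thesis using poly_Phi_primitive[OF assms(2)] by (simp add: P')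
qed

section \<open>Elements whose absolute value is a power of p\<close>

lemma cnj_lam: "cnj lam = - (z ^ (q - 1)) * lam"
proof -
  have "z ^ (q - 1) * z = 1" using z_q q_pos by (metis power_minus_mult)
  then show ?thesis by (simp add: cnj_z[simplified] algebra_simps)
qed

text \<open>
  Complex conjugation maps \<open>lam\<close> to a unit multiple of itself, so \<open>x\<close> and its conjugate contain the same
  power of the prime \<open>lam\<close>, and this is half of the power in the product.
\<close>

lemma lam_power_dvd_of_norm:
  assumes "x \<in> R" "rdvd (lam ^ (2 * a)) (x * cnj x)"
  shows "rdvd (lam ^ a) x"
  using assms
proof (induction a arbitrary: x)
  case 0
  then show ?case unfolding rdvd_def by auto
next
  case (Suc a)
  have "rdvd (lam ^ 1) (lam ^ (2 * Suc a))" by (intro rdvd_power_mono) auto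
  then have "rdvd lam (x * cnj x)" using rdvd_trans Suc.prems(2) by (metis power_one_right)
  then have "rdvd lam x \<or> rdvd lam (cnj x)"
    using lam_prime Suc.prems(1) int_adjoin_cnj by blast
  then have "rdvd lam x"
  proof
    assume "rdvd lam (cnj x)"
    then obtain s where s: "s \<in> R" "cnj x = lam * s" unfolding rdvd_def by blast
    then have "x = lam * (- (z ^ (q - 1)) * cnj s)"
      using cnj_lam by (metis complex_cnj_cnj complex_cnj_mult mult.assoc mult.commute)
    moreover have "- (z ^ (q - 1)) * cnj s \<in> R" using int_adjoin_cnj[OF s(1)] by auto
    ultimately show ?thesis unfolding rdvd_def by blast
  qed
  then obtain y where y: "y \<in> R" "x = lam * y" unfolding rdvd_def by blast
  have "z ^ (q - 1) * z = 1" using z_q q_pos by (metis power_minus_mult)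
  then have "lam ^ 2 * (y * cnj y) = (x * cnj x) * - z"
    unfolding y(2) complex_cnj_mult cnj_lam by (simp add: power2_eq_square algebra_simps)
  then have "rdvd (lam ^ (2 * Suc a)) (lam ^ 2 * (y * cnj y))"
    using rdvd_mult[OF Suc.prems(2), of "- z"] by auto
  then have "rdvd (lam ^ 2 * lam ^ (2 * a)) (lam ^ 2 * (y * cnj y))"
    by (simp flip: power_add)
  then have "rdvd (lam ^ (2 * a)) (y * cnj y)"
    using lam_nonzero by (subst (asm) rdvd_cancel) auto
  then have "rdvd (lam ^ a) y" using Suc.IH y by blast
  then show ?case unfolding y(2) power_Suc using lam_nonzero by (subst rdvd_cancel) auto
qed

lemma p_power_dvd_of_norm:
  assumes "x \<in> R" "x * cnj x = of_nat p ^ (2 * N)"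
  shows "rdvd (of_nat p ^ N) x"
proof -
  have pow: "rdvd (u ^ i) (w ^ i)" if "rdvd u w" for u w i
    using that unfolding rdvd_def by (auto simp: power_mult_distrib)
  have "rdvd (lam ^ (2 * (\<phi> * N))) (x * cnj x)"
    using pow[OF rdvd_lam_power_p, of "2 * N"] unfolding assms(2)
    by (simp only: power_mult[symmetric] mult_ac)
  then have "rdvd (lam ^ (\<phi> * N)) x" using lam_power_dvd_of_norm assms(1) by blast
  moreover have "rdvd (of_nat p ^ N) (lam ^ (\<phi> * N))"
    using pow[OF rdvd_p_lam_power, of N] by (simp only: power_mult)
  ultimately show ?thesis using rdvd_trans by blast
qed

end

section \<open>Elements of absolute value 1\<close>

lemma sum_residue_classes:
  fixes F :: "nat \<Rightarrow> 'a :: comm_monoid_add"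
  shows "(\<Sum>e<n * m. F e) = (\<Sum>r<m. \<Sum>t<n. F (r + m * t))"
proof -
  have "(\<Sum>e<n * m. F e) = (\<Sum>t<n. sum F {t * m..<t * m + m})"
    by (rule sum.nat_group[symmetric])
  also have "\<dots> = (\<Sum>t<n. \<Sum>r<m. F (r + m * t))"
  proof (rule sum.cong[OF refl])
    fix t
    show "sum F {t * m..<t * m + m} = (\<Sum>r<m. F (r + m * t))"
      using sum.shift_bounds_nat_ivl[of F 0 "t * m" m]
      by (simp add: atLeast0LessThan add.commute mult.commute)
  qed
  also have "\<dots> = (\<Sum>r<m. \<Sum>t<n. F (r + m * t))"
    by (rule sum.swap)
  finally show ?thesis .
qed

lemma int_sum_squares_eq_1:
  fixes b :: "'a \<Rightarrow> int"
  assumes "finite I" "(\<Sum>t\<in>I. (b t)\<^sup>2) = 1"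
  shows "\<exists>i\<in>I. (b i = 1 \<or> b i = -1) \<and> (\<forall>t\<in>I. t \<noteq> i \<longrightarrow> b t = 0)"
proof -
  have "\<exists>i\<in>I. b i \<noteq> 0"
  proof (rule ccontr)
    assume "\<not> (\<exists>i\<in>I. b i \<noteq> 0)"
    then have "(\<Sum>t\<in>I. (b t)\<^sup>2) = 0" by (intro sum.neutral) auto
    then show False using assms(2) by simp
  qed
  then obtain i where i: "i \<in> I" "b i \<noteq> 0" by blast
  have eq: "(b i)\<^sup>2 + (\<Sum>t\<in>I - {i}. (b t)\<^sup>2) = 1"
    using sum.remove[OF assms(1) i(1), of "\<lambda>t. (b t)\<^sup>2"] assms(2) by simp
  have "(b i)\<^sup>2 \<ge> 1" using i(2) by (smt (verit) zero_less_power2)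
  moreover have "(\<Sum>t\<in>I - {i}. (b t)\<^sup>2) \<ge> 0" by (simp add: sum_nonneg)
  ultimately have 1: "(b i)\<^sup>2 = 1" and 0: "(\<Sum>t\<in>I - {i}. (b t)\<^sup>2) = 0" using eq by linarith+
  from 0 have "\<forall>t\<in>I - {i}. (b t)\<^sup>2 = 0"
    using assms(1) by (subst (asm) sum_nonneg_eq_0_iff) auto
  then show ?thesis using i 1 by (auto simp: power2_eq_1_iff)
qed

text \<open>
  Equal to the sum of \<open>(b s - b t)\<^sup>2\<close> over all pairs \<open>s < t < n\<close>; it measures how far \<open>b\<close> is from being
  constant.
\<close>

definition spread :: "nat \<Rightarrow> (nat \<Rightarrow> int) \<Rightarrow> int" where
  "spread n b = int n * (\<Sum>t<n. (b t)\<^sup>2) - (\<Sum>t<n. b t)\<^sup>2"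

lemma spread_shift: "spread n (\<lambda>t. b t - c) = spread n b"
proof -
  have "(\<Sum>t<n. (b t - c)\<^sup>2) = (\<Sum>t<n. (b t)\<^sup>2) - 2 * c * (\<Sum>t<n. b t) + int n * c\<^sup>2"
    by (simp add: power2_diff sum.distrib sum_subtractf sum_distrib_left mult_ac)
  moreover have "(\<Sum>t<n. b t - c) = (\<Sum>t<n. b t) - int n * c"
    by (simp add: sum_subtractf)
  ultimately show ?thesis
    unfolding spread_def by (simp only:) (simp add: power2_eq_square algebra_simps)
qed

text \<open>
  Among integer vectors of odd length \<open>n\<close>, the smallest nonzero spread is \<open>n - 1\<close>, and it is attained
  only by a constant vector changed by \<open>\<plusminus>1\<close> in one place. After subtracting a constant, the sum \<open>u\<close> of the
  entries satisfies \<open>\<bar>u\<bar> < n / 2\<close>. An integer is at most its square in absolute value, so the sum \<open>N\<close> of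
  the squares is at least \<open>\<bar>u\<bar>\<close>, and the spread \<open>n N - u\<^sup>2\<close> is at least \<open>\<bar>u\<bar> (n - \<bar>u\<bar>)\<close>. For \<open>u \<noteq> 0\<close> this
  is at least \<open>n - 1\<close>, with equality only for \<open>\<bar>u\<bar> = 1\<close>; the spread is then \<open>n - 1\<close> only if
  \<open>N = 1\<close>. For \<open>u = 0\<close> it is \<open>n N\<close>.
\<close>

lemma spread_cases:
  assumes "odd n" "n > 1"
  obtains (const) c where "spread n b = 0" "\<And>t. t < n \<Longrightarrow> b t = c"
  | (peak) c e t\<^sub>0 where "spread n b = int n - 1" "e \<in> {1, -1}" "t\<^sub>0 < n"
      "\<And>t. t < n \<Longrightarrow> b t = c + (if t = t\<^sub>0 then e else 0)"
  | (large) "spread n b > int n - 1"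
proof -
  obtain h where h: "n = 2 * h + 1" using assms(1) by (elim oddE)
  have h_pos: "h \<ge> 1" using assms(2) h by simp
  define S where "S = (\<Sum>t<n. b t)"
  \<comment> \<open>Rounding the mean to the nearest integer puts the shifted sum between \<open>- h\<close> and \<open>h\<close>.\<close>
  define c where "c = (S + int h) div int n"
  define b' where "b' t = b t - c" for t
  define u where "u = S - int n * c"
  define N where "N = (\<Sum>t<n. (b' t)\<^sup>2)"
  have "u = (S + int h) mod int n - int h"
    unfolding u_def c_def by (simp add: minus_mult_div_eq_mod [symmetric])
  moreover have "0 \<le> (S + int h) mod int n" "(S + int h) mod int n < int n" using assms(2) by auto
  ultimately have u_bound: "\<bar>u\<bar> \<le> int h" using h by linarith
  have sum_b': "(\<Sum>t<n. b' t) = u"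
    by (simp add: b'_def sum_subtractf u_def S_def)
  have spread: "spread n b = int n * N - u\<^sup>2"
    using spread_shift[of n b c] unfolding b'_def[symmetric]
    by (simp add: spread_def sum_b' N_def)
  have "\<bar>u\<bar> \<le> (\<Sum>t<n. \<bar>b' t\<bar>)" unfolding sum_b'[symmetric] by (rule sum_abs)
  also have "\<dots> \<le> N" unfolding N_def
  proof (rule sum_mono)
    fix t
    show "\<bar>b' t\<bar> \<le> (b' t)\<^sup>2"
      using self_le_power[of "\<bar>b' t\<bar>" 2] by (cases "b' t = 0") auto
  qed
  finally have uN: "\<bar>u\<bar> \<le> N" .
  show thesis
  proof (cases "u = 0")
    case True
    show thesis
    proof (cases "N = 0")
      case N: True
      then have "\<forall>t\<in>{..<n}. (b' t)\<^sup>2 = 0"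
        unfolding N_def by (subst (asm) sum_nonneg_eq_0_iff) auto
      then have "b t = c" if "t < n" for t using that by (auto simp: b'_def)
      moreover have "spread n b = 0" using spread True N by simp
      ultimately show thesis using const by blast
    next
      case False
      then have "N \<ge> 1" using uN by linarith
      then have "int n * 1 \<le> int n * N" by (intro mult_left_mono) auto
      then show thesis using spread True large by simp
    qed
  next
    case False
    have ge: "int n * \<bar>u\<bar> \<le> int n * N" using uN by (intro mult_left_mono) auto
    have id: "int n * \<bar>u\<bar> - u\<^sup>2 - (int n - 1) = (\<bar>u\<bar> - 1) * (int n - 1 - \<bar>u\<bar>)"
      by (simp add: algebra_simps power2_eq_square abs_mult_self_eq)
    have pos: "int n - 1 - \<bar>u\<bar> > 0" using u_bound h h_pos by linarith
    show thesis
    proof (cases "\<bar>u\<bar> = 1")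
      case u1: True
      then have u2: "u\<^sup>2 = 1" by (metis power2_abs one_power2)
      show thesis
      proof (cases "N = 1")
        case True
        then obtain i where i: "i < n" "b' i = 1 \<or> b' i = -1" "\<forall>t<n. t \<noteq> i \<longrightarrow> b' t = 0"
          using int_sum_squares_eq_1[of "{..<n}" b'] unfolding N_def by auto
        have "b t = c + (if t = i then b' i else 0)" if "t < n" for t
          using i(3) that by (auto simp: b'_def)
        moreover have "spread n b = int n - 1" using spread u2 True by simp
        ultimately show thesis using peak[of "b' i" i c] i by auto
      next
        case False
        then have "N \<ge> 2" using uN u1 by linarith
        then have "int n * 2 \<le> int n * N" by (intro mult_left_mono) auto
        then show thesis using large spread u2 assms(2) by linarith
      qed
    next
      case u1: False
      then have "(\<bar>u\<bar> - 1) * (int n - 1 - \<bar>u\<bar>) > 0"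
        using False pos by (intro mult_pos_pos) auto
      then show thesis using large spread ge id by linarith
    qed
  qed
qed

context prime_power_root begin

text \<open>
  The equation \<open>w w\<^sup>* = 1\<close>, with conjugation written as \<open>z \<mapsto> z ^ (q - 1)\<close>, is an integral relation for
  \<open>z\<close>, so it carries over to the conjugates of \<open>z\<close>.
\<close>

lemma norm_1_at_conjugates:
  assumes "poly (of_int_poly P) z * cnj (poly (of_int_poly P) z) = 1" "\<not> p dvd j"
  shows "(cmod (poly (of_int_poly P) (z ^ j)))\<^sup>2 = 1"
proof -
  define Q where "Q = P * (P \<circ>\<^sub>p Polynomial.monom 1 (q - 1)) - 1"
  have Q: "poly (of_int_poly Q) x = poly (of_int_poly P) x * poly (of_int_poly P) (x ^ (q - 1)) - 1"
    for x :: complex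
    by (simp add: Q_def hom_distribs poly_pcompose poly_monom)
  have "poly (of_int_poly Q) z = 0"
    unfolding Q cnj_z[symmetric] poly_cnj_int using assms(1) by simp
  then have "poly (of_int_poly Q) (z ^ j) = 0" using assms(2) by (rule conjugate_root)
  moreover have "(z ^ j) ^ (q - 1) = cnj (z ^ j)"
    unfolding complex_cnj_power cnj_z by (simp only: mult.commute flip: power_mult)
  ultimately have "poly (of_int_poly P) (z ^ j) * cnj (poly (of_int_poly P) (z ^ j)) = 1"
    unfolding Q by (simp flip: poly_cnj_int)
  then have "complex_of_real ((cmod (poly (of_int_poly P) (z ^ j)))\<^sup>2) = of_real 1"
    by (simp only: complex_norm_square of_real_1)
  then show ?thesis by (simp only: of_real_eq_iff)
qed

text \<open>
  Sum the squared absolute values of all \<open>\<phi>\<close> conjugates of \<open>w\<close>, which are 1. Parseval's identity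
  evaluates the same sum taken over all \<open>q\<close>-th roots of unity by the squares of the coefficients, and
  over the non-primitive ones, which are the \<open>m\<close>-th roots of unity, by the squares of the coefficient
  sums over residue classes modulo \<open>m\<close>. The difference of the two is \<open>m\<close> times the total spread.
\<close>

lemma sum_spread_of_norm_1:
  assumes "w = (\<Sum>e<q. of_int (a e) * z ^ e)" "w * cnj w = 1"
  shows "(\<Sum>r<m. spread p (\<lambda>t. a (r + m * t))) = int p - 1"
proof -
  define P where "P = (\<Sum>e<q. Polynomial.monom (a e) e)"
  have P: "poly (of_int_poly P) x = (\<Sum>e<q. of_int (a e) * x ^ e)" for x :: complex
    by (simp add: P_def hom_distribs poly_sum poly_monom)
  define S where "S r = (\<Sum>t<p. a (r + m * t))" for r
  have all: "(\<Sum>j<q. (cmod (poly (of_int_poly P) (z ^ j)))\<^sup>2) = real q * (\<Sum>e<q. (real_of_int (a e))\<^sup>2)"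
    unfolding P using parseval_zeta[OF q_pos, of "\<lambda>e. of_int (a e)"]
    by (simp add: power_mult)
  have eq_m: "(\<Sum>t<m. (cmod (poly (of_int_poly P) (z ^ (p * t))))\<^sup>2) = real m * (\<Sum>r<m. (real_of_int (S r))\<^sup>2)"
  proof -
    \<comment> \<open>\<open>z ^ p\<close> is an \<open>m\<close>-th root of unity, so its powers see exponents only modulo \<open>m\<close>.\<close>
    have "poly (of_int_poly P) (z ^ (p * t)) = (\<Sum>r<m. of_int (S r) * zeta m ^ (t * r))" for t
    proof -
      have "poly (of_int_poly P) (z ^ (p * t)) = (\<Sum>e<p * m. of_int (a e) * (zeta m ^ t) ^ e)"
        unfolding P z_p[symmetric] q_eq[symmetric] by (simp only: power_mult)
      also have "\<dots> = (\<Sum>r<m. \<Sum>i<p. of_int (a (r + m * i)) * (zeta m ^ t) ^ (r + m * i))"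
        by (rule sum_residue_classes)
      also have "\<dots> = (\<Sum>r<m. \<Sum>i<p. of_int (a (r + m * i)) * zeta m ^ (t * r))"
      proof (intro sum.cong refl)
        fix r i
        have "(zeta m ^ t) ^ (r + m * i) = zeta m ^ (t * r) * (zeta m ^ m) ^ (t * i)"
          by (simp only: power_add power_mult[symmetric] mult_ac)
        then show "of_int (a (r + m * i)) * (zeta m ^ t) ^ (r + m * i) = of_int (a (r + m * i)) * zeta m ^ (t * r)"
          using m_pos by (simp only: zeta_power_self power_one mult_1_right)
      qed
      finally show ?thesis by (simp add: S_def sum_distrib_right)
    qed
    then show ?thesis
      using parseval_zeta[OF m_pos, of "\<lambda>r. of_int (S r)"] by simp
  qed
  have split: "(\<Sum>j<q. F j) = (\<Sum>t<m. F (p * t)) + (\<Sum>i\<in>{1..<p}. \<Sum>t<m. F (i + p * t))" for F :: "nat \<Rightarrow> real"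
  proof -
    have "(\<Sum>j<q. F j) = (\<Sum>i<p. \<Sum>t<m. F (i + p * t))"
      unfolding q_eq by (subst mult.commute) (rule sum_residue_classes)
    also have "{..<p} = insert 0 {1..<p}" using p_gt_1 by auto
    finally show ?thesis by simp
  qed
  have nd: "\<not> p dvd (i + p * t)" if "i \<in> {1..<p}" for i t
    using that by (simp add: dvd_add_left_iff nat_dvd_not_less)
  have "poly (of_int_poly P) z = w" unfolding P assms(1) ..
  then have one: "(cmod (poly (of_int_poly P) (z ^ (i + p * t))))\<^sup>2 = 1" if "i \<in> {1..<p}" for i t
    using norm_1_at_conjugates[OF _ nd[OF that]] assms(2) by blast
  have "(\<Sum>i\<in>{1..<p}. \<Sum>t<m. (cmod (poly (of_int_poly P) (z ^ (i + p * t))))\<^sup>2) = (\<Sum>i\<in>{1..<p}. \<Sum>t<m. 1)"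
    by (intro sum.cong refl) (use one in blast)
  also have "\<dots> = real m * (real p - 1)"
    using p_gt_1 by (simp add: of_nat_diff)
  finally have "real q * (\<Sum>e<q. (real_of_int (a e))\<^sup>2)
      = real m * (\<Sum>r<m. (real_of_int (S r))\<^sup>2) + real m * (real p - 1)"
    using all eq_m split by simp
  then have "real m * (real p * (\<Sum>e<q. (real_of_int (a e))\<^sup>2))
      = real m * ((\<Sum>r<m. (real_of_int (S r))\<^sup>2) + (real p - 1))"
    by (subst (asm) q_eq) (simp only: of_nat_mult distrib_left mult_ac)
  then have "real p * (\<Sum>e<q. (real_of_int (a e))\<^sup>2) = (\<Sum>r<m. (real_of_int (S r))\<^sup>2) + (real p - 1)"
    using m_pos by (metis mult_cancel_left of_nat_0_less_iff less_irrefl)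
  then have "real_of_int (int p * (\<Sum>e<q. (a e)\<^sup>2)) = real_of_int ((\<Sum>r<m. (S r)\<^sup>2) + (int p - 1))"
    by simp
  then have id: "int p * (\<Sum>e<q. (a e)\<^sup>2) = (\<Sum>r<m. (S r)\<^sup>2) + (int p - 1)"
    by (simp only: of_int_eq_iff)
  have "(\<Sum>e<q. (a e)\<^sup>2) = (\<Sum>r<m. \<Sum>t<p. (a (r + m * t))\<^sup>2)"
    unfolding q_eq by (rule sum_residue_classes)
  with id show ?thesis
    by (simp add: spread_def sum_subtractf S_def sum_distrib_left)
qed

text \<open>
  The total spread \<open>p - 1\<close> is the smallest nonzero value that the spread of a single residue class
  modulo \<open>m\<close> can take, so one class has a \<open>\<plusminus>1\<close> peak and all the others are constant. Constant classes
  contribute 0, because the \<open>p\<close>-th roots of unity sum to 0.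
\<close>

lemma norm_1_imp_root_of_unity:
  assumes "odd p" "w \<in> R" "w * cnj w = 1"
  shows "\<exists>s\<in>{1, -1}. \<exists>j<q. w = s * z ^ j"
proof -
  obtain a :: "nat \<Rightarrow> int" where a: "w = (\<Sum>e<q. of_int (a e) * z ^ e)"
    using int_adjoin_root_of_unity_span[OF z_q q_pos assms(2)] by blast
  define A where "A r t = a (r + m * t)" for r t
  have total: "(\<Sum>r<m. spread p (A r)) = int p - 1"
    unfolding A_def using sum_spread_of_norm_1[OF a assms(3)] .
  have cases: "spread p (A r) = 0 \<or> spread p (A r) \<ge> int p - 1" for r
    by (rule spread_cases[OF assms(1) p_gt_1, of "A r"]) auto
  then have nonneg: "spread p (A r) \<ge> 0" for r using p_gt_1 by (smt (verit) of_nat_1 of_nat_less_iff)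
  have "\<exists>r<m. spread p (A r) \<noteq> 0"
  proof (rule ccontr)
    assume "\<not> ?thesis"
    then have "(\<Sum>r<m. spread p (A r)) = 0" by (intro sum.neutral) auto
    then show False using total p_gt_1 by simp
  qed
  then obtain r\<^sub>0 where r0: "r\<^sub>0 < m" "spread p (A r\<^sub>0) \<noteq> 0" by blast
  have rem: "spread p (A r\<^sub>0) + (\<Sum>r\<in>{..<m} - {r\<^sub>0}. spread p (A r)) = int p - 1"
    using sum.remove[of "{..<m}" r\<^sub>0 "\<lambda>r. spread p (A r)"] total r0 by simp
  moreover have "(\<Sum>r\<in>{..<m} - {r\<^sub>0}. spread p (A r)) \<ge> 0" by (intro sum_nonneg nonneg)
  ultimately have peak: "spread p (A r\<^sub>0) = int p - 1" and rest: "(\<Sum>r\<in>{..<m} - {r\<^sub>0}. spread p (A r)) = 0"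
    using cases[of r\<^sub>0] r0 by linarith+
  have zero: "spread p (A r) = 0" if "r < m" "r \<noteq> r\<^sub>0" for r
    using rest that nonneg by (subst (asm) sum_nonneg_eq_0_iff) auto
  have sum0: "(\<Sum>t<p. zeta p ^ t) = 0"
    using sum_zeta_powers[of p 1] p_gt_1 by simp
  have block0: "(\<Sum>t<p. of_int (A r t) * zeta p ^ t) = 0" if r: "r < m" "r \<noteq> r\<^sub>0" for r
  proof -
    obtain c where "\<And>t. t < p \<Longrightarrow> A r t = c"
      using zero[OF r] p_gt_1 by (cases rule: spread_cases[OF assms(1) p_gt_1, of "A r"]) auto
    then have "(\<Sum>t<p. of_int (A r t) * zeta p ^ t) = of_int c * (\<Sum>t<p. zeta p ^ t)"
      by (simp add: sum_distrib_left)
    then show ?thesis using sum0 by simp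
  qed
  obtain c e t\<^sub>0 where et: "e \<in> {1, -1}" "t\<^sub>0 < p" "\<And>t. t < p \<Longrightarrow> A r\<^sub>0 t = c + (if t = t\<^sub>0 then e else 0)"
    using peak p_gt_1 by (cases rule: spread_cases[OF assms(1) p_gt_1, of "A r\<^sub>0"]) auto
  have "(\<Sum>t<p. of_int (A r\<^sub>0 t) * zeta p ^ t) = (\<Sum>t<p. of_int c * zeta p ^ t + (if t = t\<^sub>0 then of_int e * zeta p ^ t else 0))"
    by (intro sum.cong refl) (simp add: et(3) algebra_simps)
  also have "\<dots> = of_int c * (\<Sum>t<p. zeta p ^ t) + of_int e * zeta p ^ t\<^sub>0"
    using et(2) by (simp add: sum.distrib sum_distrib_left)
  finally have block1: "(\<Sum>t<p. of_int (A r\<^sub>0 t) * zeta p ^ t) = of_int e * zeta p ^ t\<^sub>0"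
    using sum0 by simp
  have "w = (\<Sum>r<m. \<Sum>t<p. of_int (a (r + m * t)) * z ^ (r + m * t))"
    unfolding a by (subst q_eq) (rule sum_residue_classes)
  also have "\<dots> = (\<Sum>r<m. z ^ r * (\<Sum>t<p. of_int (A r t) * zeta p ^ t))"
    unfolding z_m[symmetric] sum_distrib_left A_def power_add power_mult
    by (intro sum.cong refl) (rule mult.left_commute)
  also have "\<dots> = (\<Sum>r<m. if r = r\<^sub>0 then z ^ r\<^sub>0 * (of_int e * zeta p ^ t\<^sub>0) else 0)"
    by (intro sum.cong refl) (auto simp: block0 block1)
  also have "\<dots> = of_int e * z ^ (r\<^sub>0 + m * t\<^sub>0)"
    unfolding z_m[symmetric] using r0(1) by (simp add: power_add power_mult)
  finally have w: "w = of_int e * z ^ (r\<^sub>0 + m * t\<^sub>0)" .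
  have "m * Suc t\<^sub>0 \<le> m * p" using et(2) by (intro mult_le_mono2) simp
  then have "r\<^sub>0 + m * t\<^sub>0 < q" using r0(1) by (subst q_eq) (simp add: mult.commute)
  then show ?thesis using w et(1) by auto
qed

end

section \<open>Walsh values of generalized bent functions\<close>

lemma zeta_powi_eq_power:
  assumes "N > 0"
  shows "zeta N powi i = zeta N ^ nat (i mod int N)"
proof -
  have "zeta N powi i = zeta N powi (int N * (i div int N) + i mod int N)" by simp
  also have "\<dots> = (zeta N powi int N) powi (i div int N) * zeta N powi (i mod int N)"
    by (simp only: power_int_add zeta_nonzero power_int_mult simp_thms)
  also have "zeta N powi int N = 1" using assms by simp
  also have "zeta N powi (i mod int N) = zeta N ^ nat (i mod int N)"
    using assms by (simp add: power_int_def)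
  finally show ?thesis by simp
qed

context prime_power_root begin

text \<open>
  A square root of \<open>\<plusminus>p\<close> in \<open>R\<close>, in the product form of the quadratic Gauss sum: the factors \<open>1 - \<zeta>\<^sub>p ^ i\<close>
  of \<open>p\<close> at \<open>i = 2 j\<close> and \<open>i = p - 2 j\<close> combine to \<open>-(\<zeta>\<^sub>p ^ j - \<zeta>\<^sub>p ^ (-j))\<^sup>2\<close>, and these pairs exhaust all \<open>i\<close>.
\<close>

lemma ex_sqrt_signed_prime:
  assumes "odd p"
  shows "\<exists>g\<in>R. g\<^sup>2 = (-1) ^ ((p - 1) div 2) * of_nat p"
proof -
  obtain h where h: "p = 2 * h + 1" using assms by (elim oddE)
  define g where "g = (\<Prod>j\<in>{1..h}. zeta p ^ j - zeta p ^ (p - j))"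
  have "zeta p \<in> R" unfolding z_m[symmetric] by auto
  then have "g \<in> R" unfolding g_def by auto
  have split: "{1..<p} = (\<lambda>j. 2 * j) ` {1..h} \<union> (\<lambda>j. p - 2 * j) ` {1..h}"
  proof (intro equalityI subsetI)
    fix i assume i: "i \<in> {1..<p}"
    show "i \<in> (\<lambda>j. 2 * j) ` {1..h} \<union> (\<lambda>j. p - 2 * j) ` {1..h}"
    proof (cases "even i")
      case True
      then have "i = 2 * (i div 2)" "i div 2 \<in> {1..h}" using i h by auto
      then show ?thesis by blast
    next
      case False
      then have "i = p - 2 * ((p - i) div 2)" "(p - i) div 2 \<in> {1..h}"
        using i h by (auto elim!: oddE)
      then show ?thesis by blast
    qed
  qed (use h in auto)
  have disj: "(\<lambda>j. 2 * j) ` {1..h} \<inter> (\<lambda>j. p - 2 * j) ` {1..h} = {}"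
  proof -
    have "2 * i \<noteq> p - 2 * j" if "i \<in> {1..h}" "j \<in> {1..h}" for i j
    proof
      assume "2 * i = p - 2 * j"
      then have "p = 2 * (i + j)" using that h by simp
      then show False using assms by simp
    qed
    then show ?thesis by blast
  qed
  have pair: "(1 - zeta p ^ (2 * j)) * (1 - zeta p ^ (p - 2 * j)) = - (zeta p ^ j - zeta p ^ (p - j))\<^sup>2"
    if "j \<in> {1..h}" for j
  proof -
    define x y where "x = zeta p ^ j" and "y = zeta p ^ (p - j)"
    have "j + (p - j) = p" using that h by simp
    then have xy: "x * y = 1"
      unfolding x_def y_def power_add[symmetric] using p_gt_1 by simp
    have "2 * j \<le> p" using that h by simp
    then have "p + (p - 2 * j) = 2 * (p - j)" by linarith
    then have "zeta p ^ p * zeta p ^ (p - 2 * j) = zeta p ^ (2 * (p - j))"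
      by (metis power_add)
    then have y2: "zeta p ^ (p - 2 * j) = y\<^sup>2"
      using p_gt_1 by (simp add: y_def mult.commute flip: power_mult)
    have x2: "zeta p ^ (2 * j) = x\<^sup>2" by (simp add: x_def mult.commute flip: power_mult)
    have "(1 - x\<^sup>2) * (1 - y\<^sup>2) = 1 - x\<^sup>2 - y\<^sup>2 + (x * y)\<^sup>2"
      by (simp add: algebra_simps power_mult_distrib)
    also have "\<dots> = - (x\<^sup>2 + y\<^sup>2 - 2 * (x * y))" unfolding xy by simp
    also have "\<dots> = - (x - y)\<^sup>2" by (simp add: power2_diff mult.assoc)
    finally show ?thesis unfolding x2 y2 x_def[symmetric] y_def[symmetric] .
  qed
  have "of_nat p = (\<Prod>i\<in>{1..<p}. 1 - zeta p ^ i)"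
    using p_gt_1 by (subst prod_one_minus_zeta_eq) auto
  also have "\<dots> = (\<Prod>i\<in>(\<lambda>j. 2 * j) ` {1..h}. 1 - zeta p ^ i) * (\<Prod>i\<in>(\<lambda>j. p - 2 * j) ` {1..h}. 1 - zeta p ^ i)"
    unfolding split using disj by (intro prod.union_disjoint) auto
  also have "(\<Prod>i\<in>(\<lambda>j. 2 * j) ` {1..h}. 1 - zeta p ^ i) = (\<Prod>j\<in>{1..h}. 1 - zeta p ^ (2 * j))"
    by (subst prod.reindex) (auto simp: inj_on_def)
  also have "(\<Prod>i\<in>(\<lambda>j. p - 2 * j) ` {1..h}. 1 - zeta p ^ i) = (\<Prod>j\<in>{1..h}. 1 - zeta p ^ (p - 2 * j))"
    using h by (subst prod.reindex) (auto simp: inj_on_def)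
  also have "(\<Prod>j\<in>{1..h}. 1 - zeta p ^ (2 * j)) * (\<Prod>j\<in>{1..h}. 1 - zeta p ^ (p - 2 * j))
      = (\<Prod>j\<in>{1..h}. (-1) * (zeta p ^ j - zeta p ^ (p - j))\<^sup>2)"
    unfolding prod.distrib[symmetric] by (intro prod.cong refl) (simp add: pair)
  also have "\<dots> = (-1) ^ h * g\<^sup>2"
    unfolding g_def prod.distrib by (simp add: prod_power_distrib)
  finally have "of_nat p = (-1) ^ h * g\<^sup>2" .
  then have "g\<^sup>2 = (-1) ^ h * of_nat p"
    by (simp add: mult.assoc[symmetric] flip: power_mult_distrib)
  moreover have "(p - 1) div 2 = h" using h by simp
  ultimately show ?thesis using \<open>g \<in> R\<close> by auto
qed

text \<open>
  Multiplication by the \<open>n\<close>-th power of \<open>g = \<surd>(\<plusminus>p)\<close> raises the absolute value \<open>p ^ (n / 2)\<close> of \<open>S\<close> to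
  \<open>p ^ n\<close>, so that \<open>p ^ n\<close> can be divided out inside \<open>R\<close> also when \<open>n\<close> is odd. The quotient has absolute
  value 1 and is therefore \<open>\<plusminus>z ^ j\<close>. The factor \<open>e\<close> collects the signs and \<open>(g / \<surd>p) ^ n\<close>; only its
  square is determined.
\<close>

lemma norm_p_power_imp:
  assumes "odd p" "S \<in> R" "S * cnj S = of_nat p ^ n"
  shows "\<exists>e. \<exists>j<q. S = of_real (sqrt (real p)) ^ n * (e * z ^ j) \<and> e\<^sup>2 = (-1) ^ ((p - 1) div 2 * n)"
proof -
  define h where "h = (p - 1) div 2"
  obtain g where g: "g \<in> R" "g\<^sup>2 = (-1) ^ h * of_nat p"
    using ex_sqrt_signed_prime[OF assms(1)] unfolding h_def by blast
  have "(cmod g)\<^sup>2 = real p"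
    unfolding norm_power[symmetric] g(2) by (simp add: norm_mult norm_power)
  then have g_norm: "g * cnj g = of_nat p"
    using complex_norm_square[of g] by simp
  have "S * g ^ n \<in> R" using assms(2) g(1) by auto
  moreover have norm: "(S * g ^ n) * cnj (S * g ^ n) = of_nat p ^ (2 * n)"
  proof -
    have "(S * g ^ n) * cnj (S * g ^ n) = (S * cnj S) * (g * cnj g) ^ n"
      by (simp add: power_mult_distrib mult_ac)
    then show ?thesis unfolding assms(3) g_norm by (simp add: mult_2 power_add)
  qed
  ultimately obtain w where w: "w \<in> R" "S * g ^ n = of_nat p ^ n * w"
    using p_power_dvd_of_norm unfolding rdvd_def by blast
  have "of_nat p ^ (2 * n) * (w * cnj w) = of_nat p ^ (2 * n) * 1"
    using norm unfolding w(2) complex_cnj_mult complex_cnj_power complex_cnj_of_nat mult_2 power_add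
    by (simp only: mult_ac mult_1_left mult_1_right)
  then have "w * cnj w = 1" using p_gt_1 by (subst (asm) mult_left_cancel) auto
  then obtain s j where sj: "s \<in> {1, -1}" "j < q" "w = s * z ^ j"
    using norm_1_imp_root_of_unity assms(1) w(1) by blast
  define r where "r = complex_of_real (sqrt (real p))"
  have r2: "r\<^sup>2 = of_nat p" unfolding r_def using p_gt_1 by (simp flip: of_real_power)
  have r0: "r \<noteq> 0" using p_gt_1 by (simp add: r_def)
  define e where "e = (-1) ^ (h * n) * s * (g / r) ^ n"
  have "of_nat p ^ n * ((-1) ^ (h * n) * S) = (S * g ^ n) * g ^ n"
  proof -
    have "g ^ n * g ^ n = (g\<^sup>2) ^ n" by (simp add: power2_eq_square power_mult_distrib)
    also have "\<dots> = (-1) ^ (h * n) * of_nat p ^ n"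
      unfolding g(2) by (simp only: power_mult_distrib power_mult)
    finally show ?thesis by (simp add: mult.assoc mult.left_commute)
  qed
  also have "\<dots> = of_nat p ^ n * (s * z ^ j * g ^ n)" unfolding w(2) sj(3) by (simp add: mult_ac)
  finally have "(-1) ^ (h * n) * S = s * z ^ j * g ^ n"
    using p_gt_1 by (subst (asm) mult_left_cancel) auto
  then have "S = (-1) ^ (h * n) * (s * z ^ j * g ^ n)"
    by (metis mult.assoc mult_1_left left_minus_one_mult_self)
  also have "g ^ n = r ^ n * (g / r) ^ n" using r0 by (simp flip: power_mult_distrib)
  finally have "S = r ^ n * (e * z ^ j)" unfolding e_def by (simp only: mult_ac)
  moreover have "e\<^sup>2 = (-1) ^ (h * n)"
  proof -
    have "e\<^sup>2 = ((-1) ^ (h * n))\<^sup>2 * s\<^sup>2 * ((g / r)\<^sup>2) ^ n"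
      unfolding e_def by (simp only: power_mult_distrib power_mult[symmetric] mult.commute[of n])
    also have "(g / r)\<^sup>2 = (-1) ^ h" using g(2) r2 p_gt_1 by (simp add: power_divide)
    also have "s\<^sup>2 = 1" using sj(1) by auto
    also have "((-1) ^ (h * n))\<^sup>2 = (1 :: complex)" by (simp flip: power_mult)
    finally show ?thesis by (simp add: power_mult)
  qed
  ultimately show ?thesis using sj(2) unfolding h_def r_def by blast
qed

end

theorem lemma2p5:
  fixes p n k :: nat and f :: "(nat \<Rightarrow> int) \<Rightarrow> int"
  assumes "prime p" and "odd p" and "n > 0" and "k > 0"
    and "f \<in> Zvec p n \<rightarrow> Zmod (p ^ k)"
    and "gbent p n (p ^ k) f"
  shows "\<exists>fstar \<in> Zvec p n \<rightarrow> Zmod (p ^ k). \<forall>u \<in> Zvec p n.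
    (even n \<or> (odd n \<and> [p = 1] (mod 4)) \<longrightarrow>
       (\<exists>s \<in> {1, -1}. walsh p n (p ^ k) f u = s * zeta (p ^ k) powi fstar u)) \<and>
    (odd n \<and> [p = 3] (mod 4) \<longrightarrow>
       (\<exists>s \<in> {1, -1}. walsh p n (p ^ k) f u = s * \<i> * zeta (p ^ k) powi fstar u))"
proof -
  interpret prime_power_root p k using assms by unfold_locales
  define h where "h = (p - 1) div 2"
  have "\<exists>e. \<exists>j<q. walsh p n q f u = e * z ^ j \<and> e\<^sup>2 = (-1) ^ (h * n)" if u: "u \<in> Zvec p n" for u
  proof -
    define S where "S = (\<Sum>x\<in>Zvec p n. zeta p powi (- dotp p n u x) * z powi f x)"
    define c where "c = real p powr (- (real n / 2))"
    have c: "c * sqrt (real p) ^ n = 1"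
      using p_gt_1 by (simp add: c_def powr_half_sqrt[symmetric] powr_power powr_minus divide_simps)
    have W: "walsh p n q f u = of_real c * S" unfolding walsh_def S_def c_def ..
    have "zeta p \<in> R" unfolding z_m[symmetric] by auto
    then have "S \<in> R"
      unfolding S_def using q_pos p_gt_1
      by (intro int_adjoin_sum int_adjoin_mult)
         (simp_all add: zeta_powi_eq_power int_adjoin_power del: zero_less_power)
    moreover have "S * cnj S = of_nat p ^ n"
    proof -
      have "c > 0" using p_gt_1 by (simp add: c_def)
      have "cmod (walsh p n q f u) = 1" using assms(6) u unfolding gbent_def by blast
      then have "c * cmod S = c * sqrt (real p) ^ n"
        using \<open>c > 0\<close> c by (simp add: W norm_mult)
      then have "cmod S = sqrt (real p) ^ n" using \<open>c > 0\<close> by simp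
      then have "(cmod S)\<^sup>2 = real p ^ n" by (simp add: power2_eq_square flip: power_mult_distrib)
      then show ?thesis using complex_norm_square[of S] by simp
    qed
    ultimately obtain e j where ej: "j < q" "S = of_real (sqrt (real p)) ^ n * (e * z ^ j)" "e\<^sup>2 = (-1) ^ (h * n)"
      using norm_p_power_imp[OF assms(2)] unfolding h_def by blast
    have "walsh p n q f u = of_real (c * sqrt (real p) ^ n) * (e * z ^ j)"
      unfolding W ej(2) by simp
    then have "walsh p n q f u = e * z ^ j" unfolding c by simp
    then show ?thesis using ej by blast
  qed
  then obtain e j where ej: "\<And>u. u \<in> Zvec p n \<Longrightarrow>
      j u < q \<and> walsh p n q f u = e u * z ^ j u \<and> (e u)\<^sup>2 = (-1) ^ (h * n)"
    by metis
  define fstar where "fstar u = int (j u)" for u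
  have "fstar \<in> Zvec p n \<rightarrow> Zmod q"
    using ej by (auto simp: fstar_def Zmod_def residue_ring_def simp flip: of_nat_power)
  moreover have "walsh p n q f u = e u * z powi fstar u" if "u \<in> Zvec p n" for u
    using ej[OF that] by (simp add: fstar_def)
  moreover have "e u \<in> {1, -1}" if "u \<in> Zvec p n" "even n \<or> (odd n \<and> [p = 1] (mod 4))" for u
  proof -
    have "even (h * n)"
    proof (cases "even n")
      case False
      then have "p mod 4 = 1" using that(2) by (simp add: cong_def)
      then have "even h" unfolding h_def by presburger
      then show ?thesis by simp
    qed simp
    then show ?thesis using ej[OF that(1)] by (simp add: power2_eq_1_iff)
  qed
  moreover have "\<exists>s\<in>{1, -1}. e u = s * \<i>" if "u \<in> Zvec p n" "odd n \<and> [p = 3] (mod 4)" for u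
  proof -
    have "p mod 4 = 3" using that(2) by (simp add: cong_def)
    then have "odd h" unfolding h_def by presburger
    then have "(e u)\<^sup>2 = \<i>\<^sup>2" using ej[OF that(1)] that(2) by simp
    then have "e u = \<i> \<or> e u = - \<i>" by (simp only: power2_eq_iff)
    then show ?thesis by auto
  qed
  ultimately show ?thesis by (intro bexI[of _ fstar] ballI conjI impI) metis+
qed

end
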